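(* Let $M$ be an EMV-algebra. Then the set $\partial\mathcal S(M)$ of extremal states on $M$ equals the set $\mathcal{SM}(M)$ of state-morphisms on $M$.
   Context: An EMV-algebra is an algebra $(M;\vee,\wedge,\oplus,0)$ of type $\langle 2,2,2,0\rangle$ such that: (i) $(M;\oplus,0)$ is a commutative monoid with neutral element $0$; (ii) $(M;\vee,\wedge,0)$ is a distributive lattice with bottom element $0$ (with lattice order $\le$); (iii) for each idempotent $a$ (i.e. $a\oplus a=a$; the set of idempotents is denoted $\mathcal I(M)$), the algebra $([0,a];\oplus,\lambda_a,0,a)$ is an MV-algebra, where $[0,a]=\{x\in M: 0\le x\le a\}$ and $\lambda_a(x)=\min\{z\in[0,a]: z\oplus x=a\}$; (iv) for each $x\in M$ there is $a\in\mathcal I(M)$ with $x\le a$. For $x,y\le a\in\mathcal I(M)$ one puts $x\odot y=\lambda_a(\lambda_a(x)\oplus\lambda_a(y))$ (this does not depend on $a$). A partial operation $+$ on $M$: $x+y$ is defined iff $x\odot y=0$, and then $x+y=x\oplus y$. A state on $M$ is a map $s:M\to[0,1]$ such that $s(x+y)=s(x)+s(y)$ whenever $x+y$ is defined, and $s(a)=1$ for some $a\in M$; $\mathcal S(M)$ denotes the set of states. A state $s$ is extremal if $s=\lambda s_1+(1-\lambda)s_2$ with $s_1,s_2\in\mathcal S(M)$, $\lambda\in(0,1)$ implies $s=s_1=s_2$. A state-morphism is a map $s:M\to[0,1]$ which is an EMV-homomorphism into the MV-algebra $[0,1]$ (with $u\oplus v=\min\{u+v,1\}$), i.e. it preserves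 $\vee,\wedge,\oplus,0$ and satisfies $s(\lambda_b(x))=s(b)-s(x)$ for all $b\in\mathcal I(M)$ and $x\le b$, and such that $s(x)=1$ for some $x\in M$; $\mathcal{SM}(M)$ denotes the set of state-morphisms.
   Formalization: Condition (iii) is strengthened: the MV-algebra order of [0,a] (x below y iff λ_a(x)⊕y=a) is required to be the restriction of the lattice order of M. Conditions (i)–(iv) as listed do not imply this, and without it the equality can fail. *)

theory Defs
  imports Complex_Main
begin

section \<open>MV-algebras on a carrier set\<close>

locale mv_algebra =
  fixes A :: "'a set"
    and plus :: "'a \<Rightarrow> 'a \<Rightarrow> 'a"
    and neg :: "'a \<Rightarrow> 'a"
    and zero one :: 'a
  assumes zero_closed: "zero \<in> A"
    and one_closed: "one \<in> A"
    and neg_closed: "x \<in> A \<Longrightarrow> neg x \<in> A"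
    and plus_closed: "\<lbrakk>x \<in> A; y \<in> A\<rbrakk> \<Longrightarrow> plus x y \<in> A"
    and plus_assoc: "\<lbrakk>x \<in> A; y \<in> A; z \<in> A\<rbrakk> \<Longrightarrow> plus (plus x y) z = plus x (plus y z)"
    and plus_commute: "\<lbrakk>x \<in> A; y \<in> A\<rbrakk> \<Longrightarrow> plus x y = plus y x"
    and plus_zero: "x \<in> A \<Longrightarrow> plus x zero = x"
    and neg_neg: "x \<in> A \<Longrightarrow> neg (neg x) = x"
    and neg_zero: "neg zero = one"
    and plus_one: "x \<in> A \<Longrightarrow> plus x one = one"
    and lukasiewicz:
      "\<lbrakk>x \<in> A; y \<in> A\<rbrakk> \<Longrightarrow> plus (neg (plus (neg x) y)) y = plus (neg (plus (neg y) x)) x"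


section \<open>EMV-algebras\<close>

text \<open>
  An EMV-algebra is a whole type \<open>'a\<close>; its lattice operations and its bottom element 0 are
  the library's \<open>sup\<close>, \<open>inf\<close> and \<open>bot\<close>.
\<close>

class emv_ops = distrib_lattice + order_bot +
  fixes oplus :: "'a \<Rightarrow> 'a \<Rightarrow> 'a"  (infixl "\<oplus>" 65)
begin

definition idempotents :: "'a set" where
  "idempotents = {a. a \<oplus> a = a}"

definition lam :: "'a \<Rightarrow> 'a \<Rightarrow> 'a" where
  "lam a x = (LEAST z. z \<in> {bot..a} \<and> z \<oplus> x = a)"

end

text \<open>
  Axiom \<open>lam_exists\<close> says that the minimum in the definition of \<open>lam\<close> exists.

  Axiom \<open>mv_order\<close> says that the natural order of the MV-algebra \<open>[0,a]\<close>
  (\<open>x\<close> is below \<open>y\<close> iff the sum of the complement of \<open>x\<close> and \<open>y\<close> is the top element)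
  is the restriction of the lattice order. The usual definition of an EMV-algebra leaves this
  tacit, but it does not follow from the other axioms. Counterexample: the MV-algebra
  \<open>[0,1] \<times> {0,1}\<close>, where the lattice order is the product order with the
  comparisons between the two copies of \<open>[0,1]\<close> replaced by:
  \<open>(x,0) \<le> (y,1)\<close> iff \<open>x/2 \<le> y\<close>. There the first projection is an extremal state
  that does not preserve the lattice join.
\<close>

class emv_algebra = emv_ops +
  assumes oplus_comm_monoid: "comm_monoid oplus bot"
    and lam_exists:
      "\<lbrakk>a \<in> idempotents; x \<in> {bot..a}\<rbrakk> \<Longrightarrow>
        \<exists>z\<in>{bot..a}. z \<oplus> x = a \<and> (\<forall>w\<in>{bot..a}. w \<oplus> x = a \<longrightarrow> z \<le> w)"
    and interval_mv_algebra:
      "a \<in> idempotents \<Longrightarrow> mv_algebra {bot..a} oplus (lam a) bot a"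
    and mv_order:
      "\<lbrakk>a \<in> idempotents; x \<in> {bot..a}; y \<in> {bot..a}\<rbrakk> \<Longrightarrow> lam a x \<oplus> y = a \<longleftrightarrow> x \<le> y"
    and idempotent_above: "\<exists>a\<in>idempotents. x \<le> a"

text \<open>The value of \<open>odot x y\<close> does not depend on the choice of \<open>a\<close>.\<close>

definition odot :: "'a::emv_algebra \<Rightarrow> 'a \<Rightarrow> 'a"  (infixl "\<odot>" 70) where
  "x \<odot> y = (let a = (SOME a. a \<in> idempotents \<and> x \<le> a \<and> y \<le> a)
            in lam a (lam a x \<oplus> lam a y))"


section \<open>States\<close>

text \<open>
  The partial sum \<open>x + y\<close> is \<open>x \<oplus> y\<close>, defined iff \<open>x \<odot> y = bot\<close>.
\<close>

definition states :: "('a::emv_algebra \<Rightarrow> real) set" where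
  "states = {s. (\<forall>x. s x \<in> {0..1}) \<and>
                (\<forall>x y. x \<odot> y = bot \<longrightarrow> s (x \<oplus> y) = s x + s y) \<and>
                (\<exists>a. s a = 1)}"

definition extremal_states :: "('a::emv_algebra \<Rightarrow> real) set" where
  "extremal_states = {s \<in> states.
     \<forall>s1\<in>states. \<forall>s2\<in>states. \<forall>t\<in>{0<..<1}.
       s = (\<lambda>x. t * s1 x + (1 - t) * s2 x) \<longrightarrow> s = s1 \<and> s = s2}"

definition state_morphisms :: "('a::emv_algebra \<Rightarrow> real) set" where
  "state_morphisms = {s. (\<forall>x. s x \<in> {0..1}) \<and>
     (\<forall>x y. s (sup x y) = max (s x) (s y)) \<and>
     (\<forall>x y. s (inf x y) = min (s x) (s y)) \<and>
     (\<forall>x y. s (x \<oplus> y) = min (s x + s y) 1) \<and>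
     s bot = 0 \<and>
     (\<forall>b\<in>idempotents. \<forall>x. x \<le> b \<longrightarrow> s (lam b x) = s b - s x) \<and>
     (\<exists>x. s x = 1)}"

end

theory Submission
  imports Defs
begin

text \<open>
  If a state-morphism \<open>s\<close> is a convex combination of states, each of these states takes
  the values 0 and 1 wherever \<open>s\<close> does. Doubling an element, by \<open>x \<oplus> x\<close> or
  \<open>x \<odot> x\<close>, doubles the difference of two such functions, so they agree.

  Conversely, for an extremal state \<open>s\<close> and an element \<open>f\<close> with \<open>s f > 0\<close>, the
  function \<open>x \<mapsto> sup\<^sub>n s (x \<and> n f)\<close> is additive, lies below \<open>s\<close> and agrees with
  \<open>s\<close> at \<open>f\<close>; extremality makes it equal to \<open>s\<close>. Hence \<open>s\<close> vanishes at every
  \<open>g\<close> with \<open>f \<and> g = 0\<close>. Applied to the disjoint parts of \<open>x\<close> and \<open>y\<close> outside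
  \<open>x \<and> y\<close>, this shows that \<open>s\<close> preserves the lattice operations, and the rest follows
  from \<open>x \<oplus> y = x + (\<lambda>\<^sub>a x \<and> y)\<close>.
\<close>

section \<open>MV-algebras with a compatible lattice order\<close>

text \<open>The carrier sits inside a lattice type so that all intervals [0,a] of one EMV-algebra
  are instances at once. Order, \<open>inf\<close> and \<open>sup\<close> are those of the whole
  type, hence the closure assumptions.\<close>

locale mv_lattice = mv_algebra A plus neg zero one
  for A :: "'a::lattice set"
    and plus :: "'a \<Rightarrow> 'a \<Rightarrow> 'a"  (infixl "\<^bold>+" 65)
    and neg :: "'a \<Rightarrow> 'a"
    and zero one :: 'a +
  assumes le_iff: "\<lbrakk>x \<in> A; y \<in> A\<rbrakk> \<Longrightarrow> x \<le> y \<longleftrightarrow> neg x \<^bold>+ y = one"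
    and inf_closed: "\<lbrakk>x \<in> A; y \<in> A\<rbrakk> \<Longrightarrow> inf x y \<in> A"
    and sup_closed: "\<lbrakk>x \<in> A; y \<in> A\<rbrakk> \<Longrightarrow> sup x y \<in> A"
begin

lemmas closed [simp] = zero_closed one_closed neg_closed plus_closed inf_closed sup_closed

lemmas units [simp] = neg_neg neg_zero plus_zero plus_one

text \<open>Truncated difference: in the MV-algebra [0,1] it is max(x - y, 0).\<close>

definition diff :: "'a \<Rightarrow> 'a \<Rightarrow> 'a"  (infixl "\<^bold>-" 65) where
  "x \<^bold>- y = neg (neg x \<^bold>+ y)"

lemma diff_closed [simp]: "\<lbrakk>x \<in> A; y \<in> A\<rbrakk> \<Longrightarrow> x \<^bold>- y \<in> A"
  by (simp add: diff_def)

lemma neg_one [simp]: "neg one = zero"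
  using neg_neg[OF zero_closed] by simp

lemma zero_plus [simp]: "x \<in> A \<Longrightarrow> zero \<^bold>+ x = x"
  using plus_commute[of x zero] by simp

lemma zero_le [simp]: "x \<in> A \<Longrightarrow> zero \<le> x"
  using plus_commute[of one x] by (simp add: le_iff)

lemma neg_plus [simp]: "x \<in> A \<Longrightarrow> neg x \<^bold>+ x = one"
  using le_iff[of x x] by simp

text \<open>Residuation: by \<open>le_iff\<close> and associativity both sides say that neg x + y +
  z is \<open>one\<close>.\<close>

lemma diff_le_iff:
  assumes "x \<in> A" "y \<in> A" "z \<in> A"
  shows "x \<^bold>- y \<le> z \<longleftrightarrow> x \<le> y \<^bold>+ z"
  using assms by (simp add: diff_def le_iff plus_assoc)

lemma le_plus1: "\<lbrakk>x \<in> A; y \<in> A\<rbrakk> \<Longrightarrow> x \<le> x \<^bold>+ y"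
  using plus_commute[of one y] by (simp add: le_iff flip: plus_assoc)

lemma le_plus2: "\<lbrakk>x \<in> A; y \<in> A\<rbrakk> \<Longrightarrow> x \<le> y \<^bold>+ x"
  using le_plus1[of x y] plus_commute[of x y] by simp

lemma plus_mono2:
  assumes "x \<in> A" "y \<in> A" "z \<in> A" "y \<le> z"
  shows "x \<^bold>+ y \<le> x \<^bold>+ z"
proof -
  have "(x \<^bold>+ y) \<^bold>- x \<le> y"
    using assms by (simp add: diff_le_iff)
  then have "(x \<^bold>+ y) \<^bold>- x \<le> z"
    using assms(4) by (rule order_trans)
  then show ?thesis
    using assms by (simp add: diff_le_iff)
qed

lemma plus_mono:
  assumes "x \<in> A" "y \<in> A" "z \<in> A" "w \<in> A" "x \<le> y" "z \<le> w"
  shows "x \<^bold>+ z \<le> y \<^bold>+ w"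
proof -
  have "x \<^bold>+ z \<le> x \<^bold>+ w"
    using assms by (simp add: plus_mono2)
  also have "\<dots> \<le> y \<^bold>+ w"
    using plus_mono2[of w x y] assms by (simp add: plus_commute[of w])
  finally show ?thesis .
qed

lemma neg_le_neg_iff: "\<lbrakk>x \<in> A; y \<in> A\<rbrakk> \<Longrightarrow> neg x \<le> neg y \<longleftrightarrow> y \<le> x"
  by (simp add: le_iff plus_commute)

lemma neg_diff_neg: "\<lbrakk>x \<in> A; y \<in> A\<rbrakk> \<Longrightarrow> neg x \<^bold>- neg y = y \<^bold>- x"
  by (simp add: diff_def plus_commute)

lemma diff_le: "\<lbrakk>x \<in> A; y \<in> A\<rbrakk> \<Longrightarrow> x \<^bold>- y \<le> x"
  by (simp add: diff_le_iff le_plus2)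

lemma diff_le_neg: "\<lbrakk>x \<in> A; y \<in> A\<rbrakk> \<Longrightarrow> x \<^bold>- y \<le> neg y"
  unfolding diff_def by (simp add: neg_le_neg_iff le_plus2)

section \<open>Lattice operations expressed by the truncated difference\<close>

lemma plus_diff_commute: "\<lbrakk>x \<in> A; y \<in> A\<rbrakk> \<Longrightarrow> x \<^bold>+ (y \<^bold>- x) = y \<^bold>+ (x \<^bold>- y)"
  using lukasiewicz[of x y] plus_commute[of x "y \<^bold>- x"] plus_commute[of y "x \<^bold>- y"]
  by (simp add: diff_def)

lemma plus_diff:
  assumes "x \<in> A" "y \<in> A" "x \<le> y"
  shows "x \<^bold>+ (y \<^bold>- x) = y"
proof -
  have "x \<^bold>- y = zero"
    using assms by (simp add: diff_def le_iff)
  then show ?thesis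
    using assms plus_diff_commute[of x y] by simp
qed

text \<open>Residuation makes x + (y - x) an upper bound of y. It is the least one: y - x is below
  \<open>sup x y\<close> - x, and adding x restores \<open>sup x y\<close> by
  \<open>plus_diff\<close>.\<close>

lemma sup_eq:
  assumes "x \<in> A" "y \<in> A"
  shows "sup x y = x \<^bold>+ (y \<^bold>- x)"
proof (rule order_antisym)
  show "sup x y \<le> x \<^bold>+ (y \<^bold>- x)"
    using assms by (simp add: le_plus1 flip: diff_le_iff)
  have "y \<^bold>- x \<le> sup x y \<^bold>- x"
  proof -
    have "y \<le> sup x y" by simp
    also have "\<dots> = x \<^bold>+ (sup x y \<^bold>- x)"
      using assms by (simp add: plus_diff)
    finally show ?thesis
      using assms by (simp add: diff_le_iff)
  qed
  then have "x \<^bold>+ (y \<^bold>- x) \<le> x \<^bold>+ (sup x y \<^bold>- x)"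
    using assms by (simp add: plus_mono2)
  then show "x \<^bold>+ (y \<^bold>- x) \<le> sup x y"
    using assms by (simp add: plus_diff)
qed

lemma inf_eq_neg_sup:
  assumes "x \<in> A" "y \<in> A"
  shows "inf x y = neg (sup (neg x) (neg y))"
proof (rule order_antisym)
  have "sup (neg x) (neg y) \<le> neg (inf x y)"
    using assms by (simp add: neg_le_neg_iff)
  then show "inf x y \<le> neg (sup (neg x) (neg y))"
    using neg_le_neg_iff[of "neg (inf x y)" "sup (neg x) (neg y)"] assms by simp
  have "neg (sup (neg x) (neg y)) \<le> neg (neg x)" "neg (sup (neg x) (neg y)) \<le> neg (neg y)"
    using assms by (simp_all only: neg_le_neg_iff closed) simp_all
  then show "neg (sup (neg x) (neg y)) \<le> inf x y"
    using assms by simp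
qed

text \<open>De Morgan dual of \<open>sup_eq\<close>, since neg y - neg x is x - y.\<close>

lemma inf_eq:
  assumes "x \<in> A" "y \<in> A"
  shows "inf x y = x \<^bold>- (x \<^bold>- y)"
  using assms neg_diff_neg[of y x] by (simp add: inf_eq_neg_sup sup_eq diff_def)

lemma inf_plus_diff:
  assumes "x \<in> A" "y \<in> A"
  shows "inf x y \<^bold>+ (x \<^bold>- y) = x"
  using assms plus_diff[of "x \<^bold>- y" x] by (simp add: diff_le inf_eq plus_commute)

text \<open>By \<open>inf_eq\<close>, (x + y) - y is always the meet of neg y and x; the hypothesis
  makes this meet x.\<close>

lemma plus_diff_cancel:
  assumes "x \<in> A" "y \<in> A" "x \<le> neg y"
  shows "(x \<^bold>+ y) \<^bold>- y = x"
proof -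
  have "inf x (neg y) = x"
    using assms by (simp add: inf_absorb1)
  moreover have "inf (neg y) x = (x \<^bold>+ y) \<^bold>- y"
    using assms by (simp add: inf_eq diff_def plus_commute)
  ultimately show ?thesis
    by (simp add: inf_commute)
qed

lemma plus_eq_plus_inf:
  assumes "x \<in> A" "y \<in> A"
  shows "x \<^bold>+ inf (neg x) y = x \<^bold>+ y"
proof -
  have "inf (neg x) y = (x \<^bold>+ y) \<^bold>- x"
    using assms by (simp add: inf_eq diff_def plus_commute)
  then show ?thesis
    using assms by (simp add: plus_diff le_plus1)
qed

text \<open>If m is the meet of x and y and w that of the differences, then m + w is below both x
  and y, hence below m. Cancelling m leaves w = 0.\<close>

lemma inf_diff_diff:
  assumes "x \<in> A" "y \<in> A"
  shows "inf (x \<^bold>- y) (y \<^bold>- x) = zero"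
proof -
  define m where "m = inf x y"
  define w where "w = inf (x \<^bold>- y) (y \<^bold>- x)"
  have mem: "m \<in> A" "w \<in> A"
    using assms by (simp_all add: m_def w_def)
  have "m \<^bold>+ w \<le> m \<^bold>+ (x \<^bold>- y)" "m \<^bold>+ w \<le> m \<^bold>+ (y \<^bold>- x)"
    using assms mem by (simp_all add: plus_mono2 w_def)
  then have "m \<^bold>+ w \<le> inf x y"
    using assms inf_plus_diff[of x y] inf_plus_diff[of y x] by (simp add: m_def inf_commute)
  then have "m \<^bold>+ w \<le> m \<^bold>+ zero"
    using mem by (simp add: m_def)
  then have "(w \<^bold>+ m) \<^bold>- m \<le> zero"
    using mem by (simp only: diff_le_iff closed plus_commute)
  \<comment> \<open>This is the condition under which m may be cancelled.\<close>
  moreover have "w \<le> neg m"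
  proof -
    have "w \<le> x \<^bold>- y" by (simp add: w_def)
    also have "\<dots> \<le> neg y" using assms by (simp add: diff_le_neg)
    also have "\<dots> \<le> neg m" using assms mem by (simp add: neg_le_neg_iff m_def)
    finally show ?thesis .
  qed
  ultimately have "w \<le> zero"
    using mem by (simp add: plus_diff_cancel)
  then show ?thesis
    using mem by (simp add: w_def[symmetric] order_antisym)
qed

lemma le_plus_inf:
  assumes "w \<in> A" "x \<in> A" "y \<in> A" "z \<in> A" "w \<le> x \<^bold>+ y" "w \<le> x \<^bold>+ z"
  shows "w \<le> x \<^bold>+ inf y z"
  using assms by (simp flip: diff_le_iff)

text \<open>\<open>le_plus_inf\<close> is used twice: once to shrink y to its meet with z, then,
  with that summand fixed, to shrink x likewise.\<close>

lemma inf_plus_le: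
  assumes "x \<in> A" "y \<in> A" "z \<in> A"
  shows "inf (x \<^bold>+ y) z \<le> inf x z \<^bold>+ inf y z"
proof -
  let ?w = "inf (x \<^bold>+ y) z"
  have "?w \<le> z" by simp
  then have *: "?w \<le> u \<^bold>+ z" if "u \<in> A" for u
    using le_plus2[of z u] assms that by (meson order_trans)
  have "?w \<le> x \<^bold>+ inf y z"
    using assms * by (intro le_plus_inf) simp_all
  moreover have "?w \<le> inf y z \<^bold>+ z"
    using assms by (intro *) simp
  ultimately have "?w \<le> inf y z \<^bold>+ inf x z"
    using assms by (intro le_plus_inf) (simp_all add: plus_commute)
  then show ?thesis
    using assms by (simp add: plus_commute)
qed

end


section \<open>Partial sums in EMV-algebras\<close>

lemma mv_lattice_interval:
  fixes a :: "'a::emv_algebra"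
  assumes "a \<in> idempotents"
  shows "mv_lattice {bot..a} (\<oplus>) (lam a) bot a"
proof -
  interpret mv_algebra "{bot..a}" "(\<oplus>)" "lam a" bot a
    by (rule interval_mv_algebra[OF assms])
  show ?thesis
    by unfold_locales
      (use assms in \<open>auto simp: mv_order intro: le_infI1\<close>)
qed

interpretation emv: comm_monoid "(\<oplus>) :: 'a::emv_algebra \<Rightarrow> 'a \<Rightarrow> 'a" bot
  by (rule oplus_comm_monoid)

lemma obtain_idempotent:
  fixes x y z :: "'a::emv_algebra"
  obtains a where "a \<in> idempotents" "x \<le> a" "y \<le> a" "z \<le> a"
  using idempotent_above[of "sup x (sup y z)"] by auto

section \<open>Independence of the ambient interval\<close>

context
  fixes a :: "'a::emv_algebra"
  assumes a: "a \<in> idempotents"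
begin

interpretation mv_lattice "{bot..a}" "(\<oplus>)" "lam a" bot a
  by (rule mv_lattice_interval[OF a])

text \<open>Relative complements do not depend on the ambient interval: both sides are the least
  \<open>p\<close> with \<open>b \<le> y \<oplus> p\<close>.\<close>

lemma lam_eq_diff:
  assumes "b \<in> idempotents" "y \<le> b" "b \<le> a"
  shows "lam b y = lam a (lam a b \<oplus> y)"
proof -
  interpret B: mv_lattice "{bot..b}" "(\<oplus>)" "lam b" bot b
    by (rule mv_lattice_interval[OF assms(1)])
  have mem: "y \<in> {bot..a}" "b \<in> {bot..a}" "y \<in> {bot..b}" "lam b y \<in> {bot..b}"
    using assms B.neg_closed[of y] by auto
  then have mem2: "lam b y \<in> {bot..a}"
    using assms(3) by auto
  have "b \<le> y \<oplus> lam b y"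
    using mem B.neg_plus[of y] by (simp add: emv.commute)
  then have *: "diff b y \<le> lam b y"
    using diff_le_iff[of b y "lam b y"] mem mem2 by blast
  \<comment> \<open>The difference formed in [0,a] lies in [0,b], so residuation in [0,b] can be
    applied to it.\<close>
  then have mem3: "diff b y \<in> {bot..b}"
    using mem by auto
  have "y \<oplus> diff b y = b"
    using assms mem by (simp only: plus_diff)
  then have "B.diff b y \<le> diff b y"
    using B.diff_le_iff[of b y "diff b y"] mem(3) mem3 B.one_closed by simp
  moreover have "B.diff b y = lam b y"
    using mem(3) B.zero_plus[of y] by (simp only: B.diff_def B.neg_one)
  ultimately show ?thesis
    using * by (simp add: diff_def)
qed

text \<open>The complement in [0,b] is b - y, which is below \<open>lam a y\<close>. Conversely, x =
  (x + y) - y by cancellation in [0,a], and \<open>x \<oplus> y\<close> is below b.\<close>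

lemma le_lam_indep:
  assumes "b \<in> idempotents" "x \<le> b" "y \<le> b" "b \<le> a"
  shows "x \<le> lam b y \<longleftrightarrow> x \<le> lam a y"
proof -
  interpret B: mv_lattice "{bot..b}" "(\<oplus>)" "lam b" bot b
    by (rule mv_lattice_interval[OF assms(1)])
  have mem: "x \<in> {bot..a}" "y \<in> {bot..a}" "b \<in> {bot..a}" "x \<oplus> y \<in> {bot..b}"
    using assms B.plus_closed[of x y] by auto
  have eq: "lam b y = diff b y"
    using assms by (simp only: lam_eq_diff diff_def)
  show ?thesis
  proof
    assume "x \<le> lam b y"
    then show "x \<le> lam a y"
      using diff_le_neg[of b y] mem eq by simp
  next
    assume "x \<le> lam a y"
    then have "x = diff (x \<oplus> y) y"
      using mem by (simp only: plus_diff_cancel)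
    also have "\<dots> \<le> diff b y"
    proof -
      have "x \<oplus> y \<le> b" using mem by simp
      also have "b = y \<oplus> diff b y"
        using assms mem by (simp only: plus_diff)
      finally show ?thesis
        using diff_le_iff[of "x \<oplus> y" y "diff b y"] mem plus_closed[of x y] diff_closed[of b y]
        by blast
    qed
    finally show "x \<le> lam b y"
      using eq by simp
  qed
qed

end

text \<open>Frees later arguments from the choice of bound hidden in \<open>odot\<close>.\<close>

lemma odot_eq_bot_iff:
  fixes x y a :: "'a::emv_algebra"
  assumes "a \<in> idempotents" "x \<le> a" "y \<le> a"
  shows "x \<odot> y = bot \<longleftrightarrow> x \<le> lam a y"
proof -
  define b where "b = (SOME a. a \<in> idempotents \<and> x \<le> a \<and> y \<le> a)"
  have b: "b \<in> idempotents" "x \<le> b" "y \<le> b"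
    using someI[of "\<lambda>a. a \<in> idempotents \<and> x \<le> a \<and> y \<le> a" a] assms by (simp_all add: b_def)
  interpret B: mv_lattice "{bot..b}" "(\<oplus>)" "lam b" bot b
    by (rule mv_lattice_interval[OF b(1)])
  have mem: "x \<in> {bot..b}" "y \<in> {bot..b}"
    using b by simp_all
  then have mem': "lam b x \<oplus> lam b y \<in> {bot..b}"
    by (intro B.closed)
  have "x \<odot> y = lam b (lam b x \<oplus> lam b y)"
    by (simp add: odot_def b_def Let_def)
  then have "x \<odot> y = bot \<longleftrightarrow> lam b x \<oplus> lam b y = b"
    using B.neg_neg[OF mem'] by (metis B.neg_zero B.neg_one)
  also have "\<dots> \<longleftrightarrow> x \<le> lam b y"
    using mem by (simp only: B.le_iff B.closed)
  finally have *: "x \<odot> y = bot \<longleftrightarrow> x \<le> lam b y" .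
  \<comment> \<open>A common idempotent bound transfers the condition from the chosen
    \<open>b\<close> to the given \<open>a\<close>.\<close>
  obtain c where c: "c \<in> idempotents" "a \<le> c" "b \<le> c"
    using obtain_idempotent by metis
  show ?thesis
    using * le_lam_indep[OF c(1) assms c(2)] le_lam_indep[OF c(1) b c(3)] by simp
qed

lemma odot_bot_bot: "(bot::'a::emv_algebra) \<odot> bot = bot"
proof -
  obtain a :: 'a where "a \<in> idempotents"
    using idempotent_above by blast
  then show ?thesis
    using odot_eq_bot_iff[of a bot bot] by simp
qed

lemma odot_eq_bot_commute:
  fixes x y :: "'a::emv_algebra"
  shows "x \<odot> y = bot \<longleftrightarrow> y \<odot> x = bot"
proof -
  obtain a where a: "a \<in> idempotents" "x \<le> a" "y \<le> a"
    using obtain_idempotent by metis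
  interpret mv_lattice "{bot..a}" "(\<oplus>)" "lam a" bot a
    by (rule mv_lattice_interval[OF a(1)])
  show ?thesis
    using a neg_le_neg_iff[of "lam a x" y] neg_closed[of x] by (simp add: odot_eq_bot_iff)
qed

lemma oplus_mono:
  fixes x y z w :: "'a::emv_algebra"
  assumes "x \<le> y" "z \<le> w"
  shows "x \<oplus> z \<le> y \<oplus> w"
proof -
  obtain a where a: "a \<in> idempotents" "y \<le> a" "w \<le> a"
    using obtain_idempotent by metis
  interpret mv_lattice "{bot..a}" "(\<oplus>)" "lam a" bot a
    by (rule mv_lattice_interval[OF a(1)])
  show ?thesis
    using assms a by (intro plus_mono) auto
qed

lemma odot_eq_bot_mono:
  fixes x y z w :: "'a::emv_algebra"
  assumes "y \<odot> w = bot" "x \<le> y" "z \<le> w"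
  shows "x \<odot> z = bot"
proof -
  obtain a where a: "a \<in> idempotents" "y \<le> a" "w \<le> a"
    using obtain_idempotent by metis
  then have xz: "x \<le> a" "z \<le> a"
    using assms by auto
  interpret mv_lattice "{bot..a}" "(\<oplus>)" "lam a" bot a
    by (rule mv_lattice_interval[OF a(1)])
  have "y \<le> lam a w"
    using assms a by (simp add: odot_eq_bot_iff)
  also have "\<dots> \<le> lam a z"
    using neg_le_neg_iff[of w z] a xz assms by simp
  finally show ?thesis
    using xz a assms by (auto simp: odot_eq_bot_iff)
qed

section \<open>Complements and decompositions into partial sums\<close>

lemma lam_sum:
  fixes a x :: "'a::emv_algebra"
  assumes "a \<in> idempotents" "x \<le> a"
  shows "lam a x \<odot> x = bot" "lam a x \<oplus> x = a" "lam a x \<le> a"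
proof -
  interpret mv_lattice "{bot..a}" "(\<oplus>)" "lam a" bot a
    by (rule mv_lattice_interval[OF assms(1)])
  show "lam a x \<oplus> x = a" "lam a x \<le> a"
    using assms neg_plus[of x] neg_closed[of x] by simp_all
  then show "lam a x \<odot> x = bot"
    using assms by (simp add: odot_eq_bot_iff)
qed

text \<open>In an interval containing x and y, take u = x - y and v = y - x. Each difference is
  below the complement of its subtrahend, so it can be added to the subtrahend and to the smaller
  meet.\<close>

lemma riesz_decomposition:
  fixes x y :: "'a::emv_algebra"
  obtains u v where
    "inf x y \<odot> u = bot" "inf x y \<oplus> u = x"
    "inf x y \<odot> v = bot" "inf x y \<oplus> v = y"
    "x \<odot> v = bot" "x \<oplus> v = sup x y"
    "inf u v = bot"
proof -
  obtain a where a: "a \<in> idempotents" "x \<le> a" "y \<le> a"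
    using obtain_idempotent by metis
  interpret mv_lattice "{bot..a}" "(\<oplus>)" "lam a" bot a
    by (rule mv_lattice_interval[OF a(1)])
  have mem: "x \<in> {bot..a}" "y \<in> {bot..a}"
    using a by auto
  have d: "diff x y \<le> lam a y" "diff y x \<le> lam a x" "diff x y \<le> a" "diff y x \<le> a"
    using mem diff_le_neg[of x y] diff_le_neg[of y x] diff_closed[of x y] diff_closed[of y x]
    by simp_all
  have "y \<odot> diff x y = bot" "x \<odot> diff y x = bot"
    using a d by (simp_all add: odot_eq_bot_iff odot_eq_bot_commute[of _ "diff _ _"])
  then have "inf x y \<odot> diff x y = bot" "inf x y \<odot> diff y x = bot"
    by (auto elim: odot_eq_bot_mono)
  then show thesis
    using that[of "diff x y" "diff y x"] mem inf_plus_diff[of x y] inf_plus_diff[of y x]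
      inf_diff_diff[of x y] sup_eq[of x y] \<open>x \<odot> diff y x = bot\<close>
    by (simp add: inf_commute)
qed

lemma le_decomposition:
  fixes x y :: "'a::emv_algebra"
  assumes "x \<le> y"
  obtains d where "x \<odot> d = bot" "x \<oplus> d = y"
  using riesz_decomposition[of x y] assms by (metis inf_absorb1)

text \<open>Cutting y down to the complement of x makes additivity of states applicable to an
  arbitrary \<open>x \<oplus> y\<close>.\<close>

lemma oplus_lam_inf:
  fixes x y a :: "'a::emv_algebra"
  assumes "a \<in> idempotents" "x \<le> a" "y \<le> a"
  shows "x \<odot> inf (lam a x) y = bot" "x \<oplus> inf (lam a x) y = x \<oplus> y"
proof -
  interpret mv_lattice "{bot..a}" "(\<oplus>)" "lam a" bot a
    by (rule mv_lattice_interval[OF assms(1)])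
  have mem: "x \<in> {bot..a}" "y \<in> {bot..a}" "inf (lam a x) y \<in> {bot..a}"
    using assms by (auto intro: le_infI2)
  show "x \<oplus> inf (lam a x) y = x \<oplus> y"
    using mem by (simp add: plus_eq_plus_inf)
  show "x \<odot> inf (lam a x) y = bot"
    using mem assms neg_le_neg_iff[of "lam a x" "inf (lam a x) y"] neg_neg[of x] neg_closed[of x]
    by (simp add: odot_eq_bot_iff)
qed

text \<open>Here \<open>v\<close> is \<open>x \<odot> y\<close>.\<close>

lemma oplus_decomposition:
  fixes x y :: "'a::emv_algebra"
  obtains u v where
    "x \<odot> u = bot" "x \<oplus> u = x \<oplus> y" "u \<odot> v = bot" "u \<oplus> v = y"
proof -
  obtain a where a: "a \<in> idempotents" "x \<le> a" "y \<le> a"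
    using obtain_idempotent by metis
  obtain v where "inf (lam a x) y \<odot> v = bot" "inf (lam a x) y \<oplus> v = y"
    using riesz_decomposition[of "lam a x" y] by metis
  then show thesis
    using that oplus_lam_inf[OF a] by blast
qed

lemma inf_oplus_le:
  fixes x y z :: "'a::emv_algebra"
  shows "inf (x \<oplus> y) z \<le> inf x z \<oplus> inf y z"
proof -
  obtain a where a: "a \<in> idempotents" "x \<le> a" "y \<le> a" "z \<le> a"
    using obtain_idempotent by metis
  interpret mv_lattice "{bot..a}" "(\<oplus>)" "lam a" bot a
    by (rule mv_lattice_interval[OF a(1)])
  show ?thesis
    using a by (intro inf_plus_le) auto
qed


section \<open>Additive functions\<close>

text \<open>Normalization and the upper bound 1 are dropped so that pieces of a state are covered
  before rescaling.\<close>

definition additive_measure :: "('a::emv_algebra \<Rightarrow> real) \<Rightarrow> bool" where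
  "additive_measure m \<longleftrightarrow> (\<forall>x. 0 \<le> m x) \<and> (\<forall>x y. x \<odot> y = bot \<longrightarrow> m (x \<oplus> y) = m x + m y)"

lemma additive_nonneg: "additive_measure m \<Longrightarrow> 0 \<le> m x"
  by (simp add: additive_measure_def)

lemma additive_sum: "\<lbrakk>additive_measure m; x \<odot> y = bot\<rbrakk> \<Longrightarrow> m (x \<oplus> y) = m x + m y"
  by (simp add: additive_measure_def)

lemma additive_bot: "additive_measure m \<Longrightarrow> m bot = 0"
  using additive_sum[of m bot bot] odot_bot_bot by simp

lemma additive_mono:
  assumes "additive_measure m" "x \<le> y"
  shows "m x \<le> m y"
  using le_decomposition[OF assms(2)] additive_sum[OF assms(1)] additive_nonneg[OF assms(1)]
  by (metis le_add_same_cancel1)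

text \<open>As s already has value 1 at e, it vanishes on the complement of e in any larger
  idempotent, and so does m. Thus m e is the total mass of m.\<close>

lemma additive_le_at_idempotent:
  assumes "additive_measure m" and le: "\<And>x. m x \<le> s x"
    and "additive_measure s" "e \<in> idempotents" "s e = 1" "\<And>x. s x \<le> 1"
  shows "m x \<le> m e"
proof -
  obtain g where g: "g \<in> idempotents" "x \<le> g" "e \<le> g"
    using obtain_idempotent by metis
  obtain d where d: "e \<odot> d = bot" "e \<oplus> d = g"
    using le_decomposition[OF g(3)] .
  then have "s g = s e + s d" "m g = m e + m d"
    using additive_sum assms by blast+
  then have "m g \<le> m e"
    using assms(5) assms(6)[of g] le[of d] by linarith
  then show ?thesis
    using additive_mono[OF assms(1) g(2)] by linarith
qed

lemma statesD:
  assumes "s \<in> states"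
  shows "additive_measure s" "s x \<le> 1" "\<exists>e\<in>idempotents. s e = 1"
proof -
  show add: "additive_measure s" and le1: "s x \<le> 1" for x
    using assms by (auto simp: states_def additive_measure_def)
  obtain a where "s a = 1"
    using assms by (auto simp: states_def)
  moreover obtain e where "e \<in> idempotents" "a \<le> e"
    using idempotent_above by blast
  ultimately show "\<exists>e\<in>idempotents. s e = 1"
    using additive_mono[OF add] le1 by (metis order_antisym)
qed

lemma statesI:
  assumes "additive_measure s" "\<And>x. s x \<le> 1" "s a = 1"
  shows "s \<in> states"
  using assms by (auto simp: states_def additive_measure_def)


section \<open>State-morphisms are extremal states\<close>

text \<open>If x + y is defined, then \<open>x \<le> lam a y\<close> gives s x + s y \<le> s a \<le>
  1, so the truncation at 1 has no effect.\<close>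

lemma state_morphism_state:
  assumes "s \<in> state_morphisms"
  shows "s \<in> states"
proof -
  have "s (x \<oplus> y) = s x + s y" if xy: "x \<odot> y = bot" for x y
  proof -
    obtain a where a: "a \<in> idempotents" "x \<le> a" "y \<le> a"
      using obtain_idempotent by metis
    then have "x \<le> lam a y"
      using xy by (simp add: odot_eq_bot_iff)
    then have "sup x (lam a y) = lam a y"
      by (rule sup_absorb2)
    moreover have "s (sup x (lam a y)) = max (s x) (s (lam a y))"
      using assms by (simp add: state_morphisms_def)
    ultimately have "s x \<le> s (lam a y)"
      by (metis max.cobounded1)
    moreover have "s (lam a y) = s a - s y" "s a \<le> 1" "s (x \<oplus> y) = min (s x + s y) 1"
      using assms a by (auto simp: state_morphisms_def)
    ultimately show ?thesis by linarith
  qed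
  then show ?thesis
    using assms by (simp add: state_morphisms_def states_def)
qed

text \<open>The discrepancy between \<open>s'\<close> and \<open>s\<close> doubles when \<open>x\<close> is replaced by \<open>x \<oplus> x\<close>
  (if \<open>s x \<le> 1/2\<close>) or by \<open>x \<odot> x\<close> (if \<open>s x \<ge> 1/2\<close>); as it is bounded, it vanishes.\<close>

lemma state_eq_state_morphism:
  assumes s: "s \<in> state_morphisms" and s': "s' \<in> states"
    and zero: "\<And>x. s x = 0 \<Longrightarrow> s' x = 0" and one: "\<And>x. s x = 1 \<Longrightarrow> s' x = 1"
  shows "s' = s"
proof -
  have st: "additive_measure s" "additive_measure s'" "\<And>x. s x \<le> 1" "\<And>x. s' x \<le> 1"
    using statesD state_morphism_state s s' by blast+
  have double: "\<exists>y. \<bar>s' y - s y\<bar> = 2 * \<bar>s' x - s x\<bar>" for x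
  proof -
    obtain u v where uv: "x \<odot> u = bot" "x \<oplus> u = x \<oplus> x" "u \<odot> v = bot" "u \<oplus> v = x"
      by (rule oplus_decomposition)
    \<comment> \<open>Here v is \<open>x \<odot> x\<close>. For s, either v has value 0 or
      \<open>x \<oplus> x\<close> has value 1, and there s' agrees with s.\<close>
    have sum: "m (x \<oplus> x) + m v = 2 * m x" if "additive_measure m" for m
      using additive_sum[OF that uv(1)] additive_sum[OF that uv(3)] uv by simp
    have plus: "s (x \<oplus> x) = min (s x + s x) 1"
      using s by (simp add: state_morphisms_def)
    show ?thesis
    proof (cases "s x \<le> 1/2")
      case True
      then have "s v = 0"
        using plus sum[OF st(1)] by simp
      then have "s (x \<oplus> x) = 2 * s x" "s' (x \<oplus> x) = 2 * s' x"
        using zero[of v] sum[OF st(1)] sum[OF st(2)] by simp_all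
      then have "s' (x \<oplus> x) - s (x \<oplus> x) = 2 * (s' x - s x)"
        by simp
      then show ?thesis
        by (intro exI[of _ "x \<oplus> x"]) (simp only: abs_mult abs_numeral)
    next
      case False
      then have "s (x \<oplus> x) = 1"
        using plus by simp
      then have "s v = 2 * s x - 1" "s' v = 2 * s' x - 1"
        using one[of "x \<oplus> x"] sum[OF st(1)] sum[OF st(2)] by simp_all
      then have "s' v - s v = 2 * (s' x - s x)"
        by simp
      then show ?thesis
        by (intro exI[of _ v]) (simp only: abs_mult abs_numeral)
    qed
  qed
  have iter: "\<exists>y. \<bar>s' y - s y\<bar> = 2 ^ n * \<bar>s' x - s x\<bar>" for n x
  proof (induction n)
    case 0
    show ?case by auto
  next
    case (Suc n)
    then show ?case
      using double by (metis mult.assoc power_Suc)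
  qed
  show ?thesis
  proof
    fix x
    show "s' x = s x"
    proof (rule ccontr)
      assume "s' x \<noteq> s x"
      then have pos: "0 < \<bar>s' x - s x\<bar>" by simp
      obtain n where "1 / \<bar>s' x - s x\<bar> < 2 ^ n"
        using real_arch_pow[of 2] by auto
      then have "1 < 2 ^ n * \<bar>s' x - s x\<bar>"
        using pos by (simp add: divide_less_eq)
      then obtain y where "1 < \<bar>s' y - s y\<bar>"
        using iter[of n x] by metis
      then show False
        using additive_nonneg[OF st(1), of y] additive_nonneg[OF st(2), of y] st(3,4)[of y]
        by linarith
    qed
  qed
qed

lemma convex_comb_eq_0:
  fixes t p q :: real
  assumes "0 < t" "t < 1" "0 \<le> p" "0 \<le> q" "t * p + (1 - t) * q = 0"
  shows "p = 0" "q = 0"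
  using assms by (simp_all add: add_nonneg_eq_0_iff)

lemma state_morphism_extremal:
  assumes s: "s \<in> state_morphisms"
  shows "s \<in> extremal_states"
proof -
  have "s = s1 \<and> s = s2"
    if s12: "s1 \<in> states" "s2 \<in> states" and t: "t \<in> {0<..<1}"
      and eq: "s = (\<lambda>x. t * s1 x + (1 - t) * s2 x)" for s1 s2 t
  proof -
    have bounds: "0 \<le> s1 x" "s1 x \<le> 1" "0 \<le> s2 x" "s2 x \<le> 1" for x
      using statesD[OF s12(1)] statesD[OF s12(2)] by (auto simp: additive_nonneg)
    have eq': "s x = t * s1 x + (1 - t) * s2 x" for x
      using eq by metis
    have zero: "s1 x = 0" "s2 x = 0" if "s x = 0" for x
      using convex_comb_eq_0[of t "s1 x" "s2 x"] t bounds[of x] eq'[of x] that by simp_all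
    \<comment> \<open>The gaps \<open>1 - s1 x\<close> and \<open>1 - s2 x\<close> have convex
      combination 0.\<close>
    have one: "s1 x = 1" "s2 x = 1" if "s x = 1" for x
      using convex_comb_eq_0[of t "1 - s1 x" "1 - s2 x"] t bounds[of x] eq'[of x] that
      by (simp_all add: algebra_simps)
    show ?thesis
      using state_eq_state_morphism[OF s s12(1)] state_eq_state_morphism[OF s s12(2)] zero one
      by metis
  qed
  then show ?thesis
    using state_morphism_state[OF s] by (auto simp: extremal_states_def)
qed


section \<open>Extremal states are state-morphisms\<close>

lemma extremal_states_convex_comb:
  assumes "s \<in> extremal_states" "s1 \<in> states" "s2 \<in> states" "t \<in> {0<..<1}"
    and "s = (\<lambda>x. t * s1 x + (1 - t) * s2 x)"
  shows "s = s1"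
  using assms unfolding extremal_states_def by blast

text \<open>Let r = s - m and let c = m e be the total mass of m. If c < 1, then s is the convex
  combination of m / c and r / (1 - c) with weight c. Extremality gives s = m / c, and agreement at
  f forces c = 1, a contradiction.\<close>

lemma extremal_state_eq_dominated:
  assumes "s \<in> extremal_states" "additive_measure m" "\<And>x. m x \<le> s x" "m f = s f" "0 < s f"
  shows "m = s"
proof -
  have "s \<in> states"
    using assms by (simp add: extremal_states_def)
  then have s: "additive_measure s" "\<And>x. s x \<le> 1"
    using statesD by blast+
  obtain e where e: "e \<in> idempotents" "s e = 1"
    using statesD \<open>s \<in> states\<close> by blast
  define r where "r = (\<lambda>x. s x - m x)"
  define c where "c = m e"
  have r: "additive_measure r"
    using assms(2,3) s(1) by (simp add: additive_measure_def r_def)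
  have le_c: "m x \<le> c" for x
    unfolding c_def
    using additive_le_at_idempotent[OF assms(2) assms(3) s(1) e s(2)] by blast
  have r_le: "r x \<le> 1 - c" for x
    using additive_le_at_idempotent[OF r _ s(1) e, of x] s(2) assms(2) e(2)
    by (simp add: r_def c_def additive_nonneg)
  have "0 < c"
    using le_c[of f] assms by simp
  show ?thesis
  proof (cases "c = 1")
    case True
    \<comment> \<open>The remainder r then has total mass 0.\<close>
    then show ?thesis
      using r_le additive_nonneg[OF r] by (auto simp: r_def fun_eq_iff intro: antisym)
  next
    case False
    then have "c < 1"
      using assms(3)[of e] e by (simp add: c_def)
    have "(\<lambda>x. m x / c) \<in> states"
      using assms(2) le_c \<open>0 < c\<close>
      by (intro statesI[of _ e]) (auto simp: additive_measure_def add_divide_distrib c_def)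
    moreover have "(\<lambda>x. r x / (1 - c)) \<in> states"
      using r r_le \<open>c < 1\<close> e
      by (intro statesI[of _ e]) (auto simp: additive_measure_def add_divide_distrib c_def r_def)
    moreover have "s = (\<lambda>x. c * (m x / c) + (1 - c) * (r x / (1 - c)))"
      using \<open>0 < c\<close> \<open>c < 1\<close> by (simp add: r_def)
    moreover have "c \<in> {0<..<1}"
      using \<open>0 < c\<close> \<open>c < 1\<close> by simp
    ultimately have "s = (\<lambda>x. m x / c)"
      using extremal_states_convex_comb[OF assms(1), of "\<lambda>x. m x / c" "\<lambda>x. r x / (1 - c)" c]
      by blast
    then have "s f = m f / c"
      by metis
    then have "c = 1"
      using assms(4,5) \<open>0 < c\<close> by (simp add: field_simps)
    then show ?thesis
      using False by simp
  qed
qed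

section \<open>Components of an additive function\<close>

definition multiple :: "nat \<Rightarrow> 'a::emv_algebra \<Rightarrow> 'a" where
  "multiple n f = ((\<oplus>) f ^^ n) bot"

lemma multiple_0 [simp]: "multiple 0 f = bot"
  and multiple_Suc [simp]: "multiple (Suc n) f = f \<oplus> multiple n f"
  by (simp_all add: multiple_def)

lemma multiple_add: "multiple (n + k) f = multiple n f \<oplus> multiple k f"
  by (induction n) (simp_all add: emv.assoc)

lemma multiple_mono: "n \<le> k \<Longrightarrow> multiple n f \<le> multiple k f"
  using multiple_add[of n "k - n" f] oplus_mono[of "multiple n f" "multiple n f" bot]
  by simp

lemma inf_multiple_eq_bot:
  assumes "inf g f = bot"
  shows "inf g (multiple n f) = bot"
proof (induction n)
  case (Suc n)
  have "inf g (multiple (Suc n) f) \<le> inf f g \<oplus> inf (multiple n f) g"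
    using inf_oplus_le[of f "multiple n f" g] by (simp add: inf_commute)
  also have "\<dots> = bot"
    using assms Suc by (simp add: inf_commute)
  finally show ?case
    by (simp add: bot_unique)
qed (simp add: inf_absorb2)

text \<open>The mass that s places on the ideal generated by f, in which the multiples of f are
  cofinal.\<close>

definition component :: "('a::emv_algebra \<Rightarrow> real) \<Rightarrow> 'a \<Rightarrow> 'a \<Rightarrow> real" where
  "component s f x = (SUP n. s (inf x (multiple n f)))"

context
  fixes s :: "'a::emv_algebra \<Rightarrow> real"
  assumes s: "additive_measure s"
begin

lemma component_bdd: "bdd_above (range (\<lambda>n. s (inf x (multiple n f))))"
  by (rule bdd_aboveI[of _ "s x"]) (auto intro: additive_mono[OF s])

lemma le_component: "s (inf x (multiple n f)) \<le> component s f x"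
  unfolding component_def by (rule cSUP_upper[OF UNIV_I component_bdd])

lemma component_le: "component s f x \<le> s x"
  unfolding component_def by (rule cSUP_least) (auto intro: additive_mono[OF s])

lemma component_tendsto: "(\<lambda>n. s (inf x (multiple n f))) \<longlonglongrightarrow> component s f x"
  unfolding component_def
  by (rule LIMSEQ_incseq_SUP[OF component_bdd])
    (auto simp: incseq_def intro!: additive_mono[OF s] inf_mono multiple_mono)

lemma component_additive: "additive_measure (component s f)"
  unfolding additive_measure_def
proof (intro conjI allI impI)
  show "0 \<le> component s f x" for x
    using le_component[of x 0 f] additive_nonneg[OF s] by (meson order_trans)
next
  fix x y :: 'a
  assume xy: "x \<odot> y = bot"
  let ?sum = "\<lambda>n. s (inf x (multiple n f)) + s (inf y (multiple n f))"
  have sum: "s (inf x (multiple n f) \<oplus> inf y (multiple n f)) = ?sum n" for n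
    by (intro additive_sum[OF s] odot_eq_bot_mono[OF xy]) simp_all
  have lim: "?sum \<longlonglongrightarrow> component s f x + component s f y"
    by (intro tendsto_add component_tendsto)
  show "component s f (x \<oplus> y) = component s f x + component s f y"
  proof (rule antisym)
    have "s (inf (x \<oplus> y) (multiple n f)) \<le> ?sum n" for n
      unfolding sum[symmetric] by (rule additive_mono[OF s inf_oplus_le])
    then show "component s f (x \<oplus> y) \<le> component s f x + component s f y"
      using LIMSEQ_le[OF component_tendsto lim] by blast
    have "?sum n \<le> component s f (x \<oplus> y)" for n
    proof -
      \<comment> \<open>A sum of two elements below the n-fold multiple is only known to be below
        the 2n-fold one; the supremum over all n absorbs this.\<close>
      have "inf x (multiple n f) \<oplus> inf y (multiple n f) \<le> inf (x \<oplus> y) (multiple (n + n) f)"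
        by (simp add: multiple_add oplus_mono)
      then show ?thesis
        using additive_mono[OF s] le_component[of "x \<oplus> y" "n + n" f] unfolding sum[symmetric]
        by (meson order_trans)
    qed
    then show "component s f x + component s f y \<le> component s f (x \<oplus> y)"
      using LIMSEQ_le_const2[OF lim] by blast
  qed
qed

lemma component_self: "component s f f = s f"
  using le_component[of f 1 f] component_le[of f f] by (simp add: antisym)

lemma component_disjoint: "inf g f = bot \<Longrightarrow> component s f g = 0"
  by (simp add: component_def inf_multiple_eq_bot additive_bot[OF s])

end

lemma extremal_state_disjoint:
  assumes "s \<in> extremal_states" "inf f g = bot"
  shows "s f = 0 \<or> s g = 0"
proof -
  have s: "additive_measure s"
    using assms statesD by (auto simp: extremal_states_def)
  have "s g = 0" if "0 < s f"
  proof -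
    have "component s f = s"
      using that s by (intro extremal_state_eq_dominated[OF assms(1), of _ f])
        (simp_all add: component_additive component_le component_self)
    then show ?thesis
      using component_disjoint[OF s, of g f] assms(2) by (simp add: inf_commute)
  qed
  then show ?thesis
    using additive_nonneg[OF s, of f] by linarith
qed

lemma extremal_state_morphism:
  assumes ex: "s \<in> extremal_states"
  shows "s \<in> state_morphisms"
proof -
  have "s \<in> states"
    using ex by (simp add: extremal_states_def)
  then have s: "additive_measure s" "\<And>x. s x \<le> 1"
    using statesD by blast+
  obtain e where e: "e \<in> idempotents" "s e = 1"
    using statesD \<open>s \<in> states\<close> by blast
  have lattice: "s (inf x y) = min (s x) (s y)" "s (sup x y) = max (s x) (s y)" for x y
  proof -
    obtain u v where uv:
      "inf x y \<odot> u = bot" "inf x y \<oplus> u = x"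
      "inf x y \<odot> v = bot" "inf x y \<oplus> v = y"
      "x \<odot> v = bot" "x \<oplus> v = sup x y"
      "inf u v = bot"
      by (rule riesz_decomposition)
    have "s x = s (inf x y) + s u" "s y = s (inf x y) + s v" "s (sup x y) = s x + s v"
      using uv additive_sum[OF s(1)] by metis+
    \<comment> \<open>The remainders u and v are disjoint, so s vanishes at one of them, and the
      meet and join receive the smaller and the larger value.\<close>
    moreover have "s u = 0 \<or> s v = 0" "0 \<le> s u" "0 \<le> s v"
      using extremal_state_disjoint[OF ex uv(7)] additive_nonneg[OF s(1)] by simp_all
    ultimately show "s (inf x y) = min (s x) (s y)" "s (sup x y) = max (s x) (s y)"
      by linarith+
  qed
  have lam: "s (lam b x) = s b - s x" if "b \<in> idempotents" "x \<le> b" for b x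
    using additive_sum[OF s(1) lam_sum(1)[OF that]] lam_sum(2)[OF that] by simp
  have "s (x \<oplus> y) = min (s x + s y) 1" for x y
  proof -
    obtain a where a: "a \<in> idempotents" "x \<le> a" "y \<le> a" "e \<le> a"
      using obtain_idempotent by metis
    \<comment> \<open>Taking \<open>a\<close> above \<open>e\<close> makes
      \<open>s (lam a x)\<close> equal to 1 - s x, which produces the truncation at 1.\<close>
    have "s a = 1"
      using additive_mono[OF s(1) a(4)] e s(2)[of a] by simp
    then have "s (x \<oplus> y) = s x + min (1 - s x) (s y)"
      using additive_sum[OF s(1) oplus_lam_inf(1)[OF a(1-3)]] oplus_lam_inf(2)[OF a(1-3)]
        lam[OF a(1,2)] by (simp add: lattice)
    then show ?thesis by linarith
  qed
  then show ?thesis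
    using s e lattice lam by (auto simp: state_morphisms_def additive_nonneg additive_bot)
qed

theorem theorem4p7:
  shows "(extremal_states :: ('a::emv_algebra \<Rightarrow> real) set) = state_morphisms"
  using state_morphism_extremal extremal_state_morphism by blast

end
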